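(* Let $(M,K)$ be an $m$-th root Cartan space, $m\ge 3$, with mean Cartan torsion $\mathbf I=(I^i)$ and mean Landsberg curvature $\mathbf J=(J^i)$. Suppose that $K$ has isotropic mean Landsberg curvature, i.e. there is a scalar function $c=c(x)$ on $M$ such that $$J^{i}+c\,K\,I^{i}=0\qquad\text{on } T^*M\setminus\{0\}\ \text{ for all } i .$$ Then $K$ is a weakly Landsberg metric, i.e. $J^{i}=0$ for all $i$.
   Context: Let $M$ be an $n$-dimensional smooth manifold and $T^*M_0=T^*M\setminus\{0\}$. Local coordinates on $T^*M$ are written $(x,p)=(x_i,p_i)$; write $\partial^i=\partial/\partial x_i$ and $\dot\partial^i=\partial/\partial p_i$. Repeated indices are summed. All local quantities below are defined by their formulas in the charts of a fixed atlas of $M$, and identities between them are understood in these coordinates. A Cartan space $(M,K)$ is given by a positive function $K(x,p)$, smooth on $T^*M_0$, continuous on the zero section, positively $1$-homogeneous in $p$, such that $g^{ij}(x,p)=\frac12\dot\partial^i\dot\partial^jK^2$ is positive definite on $T^*M_0$; $(g_{ij})$ denotes the inverse matrix of $(g^{ij})$. It is an $m$-th root Cartan space ($m\ge3$ an integer) if $$K(x,p)=\sqrt[m]{a^{i_1\dots i_m}(x)p_{i_1}\cdots p_{i_m}},$$ with (smooth) coefficients $a^{i_1\dots i_m}(x)$ depending only on $x$ and symmetric in all indices. Put $a^{ij}(x,p)=K^{-(m-2)}a^{iji_3\dots i_m}(x)p_{i_3}\cdots p_{i_m}$; the matrix $(a^{ij})$ is invertible. Generalized Christoffel symbols: $$\{i_1\dots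 i_m,j\}=\tfrac1{2(m-1)}\big(\partial^{i_1}a^{i_2\dots i_mj}+\partial^{i_2}a^{i_3\dots i_mi_1j}+\dots+\partial^{i_m}a^{i_1\dots i_{m-1}j}-\partial^ja^{i_1\dots i_m}\big),$$ and $\{00\dots0,h\}=\{i_1\dots i_m,h\}p_{i_1}\cdots p_{i_m}$. The spray coefficients $G_r(x,p)$ (geodesics: $\ddot x_i+2G_i(x,\dot x)=0$) are the unique solution of $a^{hr}G_r=\frac{1}{mK^{m-2}}\{00\dots0,h\}$. Put $G^i_r=\dot\partial^iG_r$, $G^{ij}_r=\dot\partial^jG^i_r$, $G^{ijk}_r=\dot\partial^kG^{ij}_r$ (the Berwald curvature). Cartan torsion: $C^{ijk}=-\frac12\dot\partial^kg^{ij}$. Landsberg curvature: $L^{ijk}=-\frac12p^sG^{ijk}_s$, where $p^s=g^{sj}p_j$. Mean Cartan torsion: $I^i=g_{jk}C^{ijk}$. Mean Landsberg curvature: $J^i=g_{jk}L^{ijk}$. *)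

theory Defs
  imports "HOL-Analysis.Analysis"
begin

text \<open>Meaningful only for open \<open>S\<close>, since the derivatives are taken with the filter \<open>at x\<close>.\<close>

fun Ck_on :: "nat \<Rightarrow> 'a::euclidean_space set \<Rightarrow> ('a \<Rightarrow> 'b::real_normed_vector) \<Rightarrow> bool" where
  "Ck_on 0 S f \<longleftrightarrow> continuous_on S f"
| "Ck_on (Suc k) S f \<longleftrightarrow>
     (\<forall>x\<in>S. f differentiable (at x)) \<and>
     (\<forall>b\<in>Basis. Ck_on k S (\<lambda>x. frechet_derivative f (at x) b))"

definition smooth_on :: "'a::euclidean_space set \<Rightarrow> ('a \<Rightarrow> 'b::real_normed_vector) \<Rightarrow> bool" where
  "smooth_on S f \<longleftrightarrow> (\<forall>k. Ck_on k S f)"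

definition partial :: "'n::finite \<Rightarrow> (real^'n \<Rightarrow> real) \<Rightarrow> real^'n \<Rightarrow> real" where
  "partial i f x = deriv (\<lambda>t. f (x + t *\<^sub>R axis i 1)) 0"

type_synonym ('a, 'n) chart = "'a set \<times> ('a \<Rightarrow> real^'n)"

definition chart_range :: "('a, 'n::finite) chart \<Rightarrow> (real^'n) set" where
  "chart_range ch = snd ch ` fst ch"

definition chart_inv :: "('a, 'n::finite) chart \<Rightarrow> real^'n \<Rightarrow> 'a" where
  "chart_inv ch = inv_into (fst ch) (snd ch)"

definition transition :: "('a, 'n::finite) chart \<Rightarrow> ('a, 'n) chart \<Rightarrow> real^'n \<Rightarrow> real^'n" where
  "transition ch ch' = snd ch' \<circ> chart_inv ch"

definition smooth_manifold :: "'a topology \<Rightarrow> ('a, 'n::finite) chart set \<Rightarrow> bool" where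
  "smooth_manifold M \<A> \<longleftrightarrow>
     Hausdorff_space M \<and> second_countable M \<and>
     (\<forall>ch\<in>\<A>. openin M (fst ch) \<and> open (chart_range ch) \<and>
        homeomorphic_map (subtopology M (fst ch)) (top_of_set (chart_range ch)) (snd ch)) \<and>
     (\<Union>ch\<in>\<A>. fst ch) = topspace M \<and>
     (\<forall>ch\<in>\<A>. \<forall>ch'\<in>\<A>. smooth_on (snd ch ` (fst ch \<inter> fst ch')) (transition ch ch'))"

text \<open>A covector at \<open>q\<close> is given by its components in all charts around \<open>q\<close>, related by the
  transformation law \<open>p\<^sub>i = \<Sum>\<^sub>j (\<partial>x'\<^sub>j / \<partial>x\<^sub>i) p'\<^sub>j\<close>.  The value \<open>0\<close> at all other
  arguments is a convention that makes the representation unique.\<close>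

type_synonym ('a, 'n) covector = "('a, 'n) chart \<Rightarrow> real^'n"

definition cotangent_space ::
    "('a, 'n::finite) chart set \<Rightarrow> 'a \<Rightarrow> ('a, 'n) covector set" where
  "cotangent_space \<A> q = {\<omega>.
     (\<forall>ch. \<not> (ch \<in> \<A> \<and> q \<in> fst ch) \<longrightarrow> \<omega> ch = 0) \<and>
     (\<forall>ch\<in>\<A>. \<forall>ch'\<in>\<A>. q \<in> fst ch \<and> q \<in> fst ch' \<longrightarrow>
        \<omega> ch = transpose (jacobian (transition ch ch') (at (snd ch q))) *v \<omega> ch')}"

text \<open>The covector at the point with coordinates \<open>x\<close> whose components in the chart \<open>ch\<close> are \<open>p\<close>.\<close>

definition covector_of ::
    "('a, 'n::finite) chart set \<Rightarrow> ('a, 'n) chart \<Rightarrow> real^'n \<Rightarrow> real^'n \<Rightarrow> ('a, 'n) covector" where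
  "covector_of \<A> ch x p = (\<lambda>ch'.
     if ch' \<in> \<A> \<and> chart_inv ch x \<in> fst ch'
     then transpose (jacobian (transition ch' ch) (at (snd ch' (chart_inv ch x)))) *v p
     else 0)"

definition local_expr ::
    "('a, 'n::finite) chart set \<Rightarrow> ('a \<Rightarrow> ('a, 'n) covector \<Rightarrow> real) \<Rightarrow> ('a, 'n) chart \<Rightarrow>
     real^'n \<Rightarrow> real^'n \<Rightarrow> real" where
  "local_expr \<A> K ch x p = K (chart_inv ch x) (covector_of \<A> ch x p)"

text \<open>From here on, \<open>F\<close> is the expression of \<open>K\<close> in one chart, and \<open>F x p\<close> its value.\<close>

definition g_up :: "(real^'n \<Rightarrow> real^'n \<Rightarrow> real) \<Rightarrow> real^'n \<Rightarrow> real^'n \<Rightarrow> real^'n::finite^'n" where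
  "g_up F x p = (\<chi> i j. 1/2 * partial i (partial j (\<lambda>p. (F x p)\<^sup>2)) p)"

definition g_down :: "(real^'n \<Rightarrow> real^'n \<Rightarrow> real) \<Rightarrow> real^'n \<Rightarrow> real^'n \<Rightarrow> real^'n::finite^'n" where
  "g_down F x p = matrix_inv (g_up F x p)"

text \<open>Positivity is required off the zero section only; \<open>K\<close> vanishes on it by homogeneity.\<close>

definition Cartan_space ::
    "'a topology \<Rightarrow> ('a, 'n::finite) chart set \<Rightarrow> ('a \<Rightarrow> ('a, 'n) covector \<Rightarrow> real) \<Rightarrow> bool" where
  "Cartan_space M \<A> K \<longleftrightarrow>
     smooth_manifold M \<A> \<and>
     (\<forall>q\<in>topspace M. \<forall>\<omega>\<in>cotangent_space \<A> q.
        (\<omega> \<noteq> (\<lambda>_. 0) \<longrightarrow> K q \<omega> > 0) \<and>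
        (\<forall>r>0. K q (\<lambda>ch. r *\<^sub>R \<omega> ch) = r * K q \<omega>)) \<and>
     (\<forall>ch\<in>\<A>.
        smooth_on (chart_range ch \<times> (- {0})) (\<lambda>(x, p). local_expr \<A> K ch x p) \<and>
        continuous_on (chart_range ch \<times> UNIV) (\<lambda>(x, p). local_expr \<A> K ch x p) \<and>
        (\<forall>x\<in>chart_range ch. \<forall>p. p \<noteq> 0 \<longrightarrow>
           (\<forall>v. v \<noteq> 0 \<longrightarrow> v \<bullet> (g_up (local_expr \<A> K ch) x p *v v) > 0)))"

text \<open>The coefficients \<open>a\<^sup>i\<^sup>1\<^sup>\<dots>\<^sup>i\<^sup>m\<close> in one chart are indexed by lists of length \<open>m\<close>.\<close>

type_synonym 'n coeffs = "'n list \<Rightarrow> real^'n \<Rightarrow> real"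

definition monom_p :: "'n list \<Rightarrow> real^'n::finite \<Rightarrow> real" where
  "monom_p is p = (\<Prod>i\<leftarrow>is. p $ i)"

definition mth_root_Cartan_space ::
    "nat \<Rightarrow> 'a topology \<Rightarrow> ('a, 'n::finite) chart set \<Rightarrow> (('a, 'n) chart \<Rightarrow> 'n coeffs) \<Rightarrow>
     ('a \<Rightarrow> ('a, 'n) covector \<Rightarrow> real) \<Rightarrow> bool" where
  "mth_root_Cartan_space m M \<A> a K \<longleftrightarrow>
     m \<ge> 3 \<and> Cartan_space M \<A> K \<and>
     (\<forall>ch\<in>\<A>.
        (\<forall>is. length is = m \<longrightarrow> smooth_on (chart_range ch) (a ch is)) \<and>
        (\<forall>is js. length is = m \<and> mset is = mset js \<longrightarrow>
           (\<forall>x\<in>chart_range ch. a ch is x = a ch js x)) \<and>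
        (\<forall>x\<in>chart_range ch. \<forall>p.
           local_expr \<A> K ch x p = root m (\<Sum>is | length is = m. a ch is x * monom_p is p)))"

text \<open>The matrix \<open>a\<^sup>i\<^sup>j\<close>, invertible off the zero section because \<open>g\<^sup>i\<^sup>j\<close> is positive definite.\<close>

definition a_up ::
    "nat \<Rightarrow> 'n coeffs \<Rightarrow> (real^'n \<Rightarrow> real^'n \<Rightarrow> real) \<Rightarrow> real^'n \<Rightarrow> real^'n \<Rightarrow> real^'n::finite^'n" where
  "a_up m a F x p =
     (\<chi> i j. 1 / F x p ^ (m - 2) * (\<Sum>is | length is = m - 2. a (i # j # is) x * monom_p is p))"

text \<open>\<open>rotate k is\<close> is \<open>i\<^sub>k\<^sub>+\<^sub>1 \<dots> i\<^sub>m i\<^sub>1 \<dots> i\<^sub>k\<close>.\<close>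

definition christoffel :: "nat \<Rightarrow> 'n coeffs \<Rightarrow> 'n list \<Rightarrow> 'n::finite \<Rightarrow> real^'n \<Rightarrow> real" where
  "christoffel m a is j x =
     1 / (2 * (real m - 1)) *
     ((\<Sum>k<m. partial (hd (rotate k is)) (a (tl (rotate k is) @ [j])) x) - partial j (a is) x)"

definition christoffel0 :: "nat \<Rightarrow> 'n coeffs \<Rightarrow> 'n::finite \<Rightarrow> real^'n \<Rightarrow> real^'n \<Rightarrow> real" where
  "christoffel0 m a h x p = (\<Sum>is | length is = m. christoffel m a is h x * monom_p is p)"

definition spray ::
    "nat \<Rightarrow> 'n coeffs \<Rightarrow> (real^'n \<Rightarrow> real^'n \<Rightarrow> real) \<Rightarrow> real^'n \<Rightarrow> real^'n \<Rightarrow> real^'n::finite" where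
  "spray m a F x p =
     (THE G. \<forall>h. (\<Sum>r\<in>UNIV. a_up m a F x p $ h $ r * G $ r)
                 = 1 / (real m * F x p ^ (m - 2)) * christoffel0 m a h x p)"

definition berwald ::
    "nat \<Rightarrow> 'n coeffs \<Rightarrow> (real^'n \<Rightarrow> real^'n \<Rightarrow> real) \<Rightarrow> 'n \<Rightarrow> 'n \<Rightarrow> 'n \<Rightarrow> 'n::finite \<Rightarrow>
     real^'n \<Rightarrow> real^'n \<Rightarrow> real" where
  "berwald m a F i j k r x p =
     partial k (partial j (partial i (\<lambda>p. spray m a F x p $ r))) p"

definition cartan_torsion ::
    "(real^'n \<Rightarrow> real^'n \<Rightarrow> real) \<Rightarrow> 'n \<Rightarrow> 'n \<Rightarrow> 'n::finite \<Rightarrow> real^'n \<Rightarrow> real^'n \<Rightarrow> real" where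
  "cartan_torsion F i j k x p = - (1/2) * partial k (\<lambda>p. g_up F x p $ i $ j) p"

definition p_up ::
    "(real^'n \<Rightarrow> real^'n \<Rightarrow> real) \<Rightarrow> 'n::finite \<Rightarrow> real^'n \<Rightarrow> real^'n \<Rightarrow> real" where
  "p_up F s x p = (\<Sum>j\<in>UNIV. g_up F x p $ s $ j * p $ j)"

definition landsberg ::
    "nat \<Rightarrow> 'n coeffs \<Rightarrow> (real^'n \<Rightarrow> real^'n \<Rightarrow> real) \<Rightarrow> 'n \<Rightarrow> 'n \<Rightarrow> 'n::finite \<Rightarrow>
     real^'n \<Rightarrow> real^'n \<Rightarrow> real" where
  "landsberg m a F i j k x p = - (1/2) * (\<Sum>s\<in>UNIV. p_up F s x p * berwald m a F i j k s x p)"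

definition mean_cartan ::
    "(real^'n \<Rightarrow> real^'n \<Rightarrow> real) \<Rightarrow> 'n::finite \<Rightarrow> real^'n \<Rightarrow> real^'n \<Rightarrow> real" where
  "mean_cartan F i x p =
     (\<Sum>j\<in>UNIV. \<Sum>k\<in>UNIV. g_down F x p $ j $ k * cartan_torsion F i j k x p)"

definition mean_landsberg ::
    "nat \<Rightarrow> 'n coeffs \<Rightarrow> (real^'n \<Rightarrow> real^'n \<Rightarrow> real) \<Rightarrow> 'n::finite \<Rightarrow>
     real^'n \<Rightarrow> real^'n \<Rightarrow> real" where
  "mean_landsberg m a F i x p =
     (\<Sum>j\<in>UNIV. \<Sum>k\<in>UNIV. g_down F x p $ j $ k * landsberg m a F i j k x p)"

definition isotropic_mean_landsberg ::
    "nat \<Rightarrow> ('a, 'n::finite) chart set \<Rightarrow> (('a, 'n) chart \<Rightarrow> 'n coeffs) \<Rightarrow>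
     ('a \<Rightarrow> ('a, 'n) covector \<Rightarrow> real) \<Rightarrow> bool" where
  "isotropic_mean_landsberg m \<A> a K \<longleftrightarrow>
     (\<exists>c :: 'a \<Rightarrow> real. \<forall>ch\<in>\<A>. \<forall>x\<in>chart_range ch. \<forall>p. p \<noteq> 0 \<longrightarrow>
        (\<forall>i. mean_landsberg m (a ch) (local_expr \<A> K ch) i x p
             + c (chart_inv ch x) * local_expr \<A> K ch x p
               * mean_cartan (local_expr \<A> K ch) i x p = 0))"

definition weakly_landsberg ::
    "nat \<Rightarrow> ('a, 'n::finite) chart set \<Rightarrow> (('a, 'n) chart \<Rightarrow> 'n coeffs) \<Rightarrow>
     ('a \<Rightarrow> ('a, 'n) covector \<Rightarrow> real) \<Rightarrow> bool" where
  "weakly_landsberg m \<A> a K \<longleftrightarrow>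
     (\<forall>ch\<in>\<A>. \<forall>x\<in>chart_range ch. \<forall>p. p \<noteq> 0 \<longrightarrow>
        (\<forall>i. mean_landsberg m (a ch) (local_expr \<A> K ch) i x p = 0))"

end

theory Submission
  imports Defs
begin

text \<open>Positivity of \<open>K\<close> at \<open>p\<close> and at \<open>-p\<close> forces \<open>m\<close> to be even, so \<open>K\<close> is reversible:
  \<open>K(x, -p) = K(x, p)\<close>.  Counting derivatives in \<open>p\<close>, \<open>g\<^sup>i\<^sup>j\<close> and \<open>G\<^sub>r\<close> are even, hence \<open>C\<^sup>i\<^sup>j\<^sup>k\<close>,
  \<open>I\<^sup>i\<close>, \<open>p\<^sup>s\<close> and the Berwald curvature are odd and \<open>J\<^sup>i\<close> is even.  In \<open>J\<^sup>i + c K I\<^sup>i = 0\<close>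
  the first term is even and the second odd, so both vanish.  The analytic content is that
  all the derivatives exist off the zero section (\<open>deriv\<close> has an arbitrary value, which need
  not respect parity, where they do not).\<close>

section \<open>Partial derivatives and parity\<close>

text \<open>\<open>partial\<close> is defined through \<open>deriv\<close>, whose value is arbitrary
  where no derivative exists. Differentiability makes it a genuine derivative along the axis line,
  to which the usual rules apply.\<close>

lemma differentiable_along_axis:
  fixes f :: "real^'n::finite \<Rightarrow> real"
  assumes "f differentiable (at p)"
  shows "((\<lambda>t. f (p + t *\<^sub>R axis i 1)) has_real_derivative partial i f p) (at 0)"
proof -
  obtain D where D: "(f has_derivative D) (at p)"
    using assms by (auto simp: differentiable_def)
  have "((\<lambda>t::real. p + t *\<^sub>R axis i 1) has_derivative (\<lambda>t. t *\<^sub>R axis i 1)) (at 0)"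
    by (auto intro!: derivative_eq_intros)
  from has_derivative_compose[OF this, of f D] D
  have "((\<lambda>t. f (p + t *\<^sub>R axis i 1)) has_derivative (\<lambda>t. D (t *\<^sub>R axis i 1))) (at 0)"
    by simp
  moreover have "(\<lambda>t. D (t *\<^sub>R axis i 1)) = (*) (D (axis i 1))"
    using linear_cmul[OF has_derivative_linear[OF D]] by (auto simp: mult.commute)
  ultimately have "((\<lambda>t. f (p + t *\<^sub>R axis i 1)) has_real_derivative D (axis i 1)) (at 0)"
    by (simp add: has_field_derivative_def)
  then show ?thesis
    using DERIV_imp_deriv by (fastforce simp: partial_def)
qed

lemma partial_eqI:
  assumes "((\<lambda>t. f (p + t *\<^sub>R axis i 1)) has_real_derivative d) (at 0)"
  shows "partial i f p = d"
  using DERIV_imp_deriv[OF assms] by (simp add: partial_def)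

lemma eventually_along_axis:
  fixes p :: "real^'n::finite"
  assumes "open S" "p \<in> S"
  shows "\<forall>\<^sub>F t in nhds 0. p + t *\<^sub>R axis i 1 \<in> S"
proof -
  have "continuous_on UNIV (\<lambda>t::real. p + t *\<^sub>R axis i 1)"
    by (intro continuous_intros)
  then have "open ((\<lambda>t::real. p + t *\<^sub>R axis i 1) -` S)"
    using \<open>open S\<close> by (simp add: continuous_on_open_vimage)
  then show ?thesis
    using eventually_nhds_in_open[of _ 0] \<open>p \<in> S\<close> by fastforce
qed

lemma partial_cong:
  fixes p :: "real^'n::finite"
  assumes "open S" "p \<in> S" "\<And>q. q \<in> S \<Longrightarrow> f q = g q"
  shows "partial i f p = partial i g p"
  unfolding partial_def
  by (rule deriv_cong_ev[OF _ refl])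
    (use eventually_along_axis[OF assms(1,2), of i] assms(3) in \<open>auto elim: eventually_mono\<close>)

lemma open_Compl_0: "open (- {0 :: real^'n::finite})"
  by (simp add: open_Compl)

text \<open>Reflecting the axis line through p sends t to -t, so the chain rule contributes one
  sign. The factor s is 1 for even and -1 for odd f.\<close>

lemma partial_minus:
  fixes f :: "real^'n::finite \<Rightarrow> real"
  assumes diff: "f differentiable (at p)" and "p \<noteq> 0"
    and par: "\<And>q. q \<noteq> 0 \<Longrightarrow> f (- q) = s * f q"
  shows "partial i f (- p) = - s * partial i f p"
proof -
  have "((\<lambda>t. f (p + (- t) *\<^sub>R axis i 1)) has_real_derivative - partial i f p) (at 0)"
    using DERIV_mirror[of "\<lambda>t. f (p + t *\<^sub>R axis i 1)" "partial i f p" 0]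
      differentiable_along_axis[OF diff, of i] by simp
  then have "((\<lambda>t. s * f (p + (- t) *\<^sub>R axis i 1)) has_real_derivative - s * partial i f p) (at 0)"
    by (auto intro!: derivative_eq_intros)
  \<comment> \<open>Parity is available only away from 0, so the two functions of t are compared
    near t = 0 only.\<close>
  moreover have "\<forall>\<^sub>F t in nhds 0. s * f (p + (- t) *\<^sub>R axis i 1) = f (- p + t *\<^sub>R axis i 1)"
  proof -
    have "\<forall>\<^sub>F t in nhds 0. - p + t *\<^sub>R axis i 1 \<in> - {0}"
      by (rule eventually_along_axis) (use \<open>p \<noteq> 0\<close> in \<open>auto simp: open_Compl_0\<close>)
    then show ?thesis
    proof eventually_elim
      case (elim t)
      then have "p + (- t) *\<^sub>R axis i 1 \<noteq> 0"
        by (auto simp: algebra_simps)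
      from par[OF this] show ?case
        by (simp add: algebra_simps)
    qed
  qed
  ultimately have "((\<lambda>t. f (- p + t *\<^sub>R axis i 1)) has_real_derivative - s * partial i f p) (at 0)"
    by (subst (asm) DERIV_cong_ev[OF refl _ refl])
  then show ?thesis
    by (rule partial_eqI)
qed

section \<open>A class of functions closed under partial derivatives\<close>

text \<open>An explicit class containing the functions of p that get differentiated. Since it is
  closed under \<open>partial\<close>, iterated derivatives exist off 0. The side conditions keep
  \<open>inverse\<close> and \<open>root\<close> away from the argument 0; \<open>cong\<close>
  leaves the value at p = 0 free, where derivative formulas may fail.\<close>

inductive algebraic_off_0 :: "(real^'n::finite \<Rightarrow> real) \<Rightarrow> bool" where
  const: "algebraic_off_0 (\<lambda>_. r)"
| coord: "algebraic_off_0 (\<lambda>p. p $ j)"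
| add: "algebraic_off_0 f \<Longrightarrow> algebraic_off_0 g \<Longrightarrow> algebraic_off_0 (\<lambda>p. f p + g p)"
| mult: "algebraic_off_0 f \<Longrightarrow> algebraic_off_0 g \<Longrightarrow> algebraic_off_0 (\<lambda>p. f p * g p)"
| inverse: "algebraic_off_0 f \<Longrightarrow> (\<And>p. p \<noteq> 0 \<Longrightarrow> f p \<noteq> 0) \<Longrightarrow> algebraic_off_0 (\<lambda>p. inverse (f p))"
| root: "algebraic_off_0 f \<Longrightarrow> (\<And>p. p \<noteq> 0 \<Longrightarrow> f p > 0) \<Longrightarrow> m > 0 \<Longrightarrow>
    algebraic_off_0 (\<lambda>p. root m (f p))"
| cong: "algebraic_off_0 f \<Longrightarrow> (\<And>p. p \<noteq> 0 \<Longrightarrow> g p = f p) \<Longrightarrow> algebraic_off_0 g"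

text \<open>The derivative is written with the root itself and the reciprocal of its argument, the
  shape that the closure rules of \<open>algebraic_off_0\<close> accept directly.\<close>

lemma DERIV_real_root_pos:
  assumes "m > 0" "y > 0"
  shows "(root m has_real_derivative root m y * inverse y / real m) (at y)"
proof -
  have "root m y ^ m = y"
    using assms by simp
  then have "inverse (real m * root m y ^ (m - Suc 0)) = root m y * inverse y / real m"
    using assms by (cases m) (auto simp: divide_simps)
  then show ?thesis
    using DERIV_real_root[OF assms] by simp
qed

text \<open>Both claims need a common induction: the differentiation rules that compute
  \<open>partial i f\<close> presuppose that the constituents are differentiable.\<close>

lemma algebraic_off_0_partial_aux:
  fixes f :: "real^'n::finite \<Rightarrow> real"
  assumes "algebraic_off_0 f"
  shows "(\<forall>p. p \<noteq> 0 \<longrightarrow> f differentiable (at p)) \<and> (\<forall>i. algebraic_off_0 (partial i f))"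
  using assms
proof induction
  case (const r)
  have "partial i (\<lambda>_::real^'n. r) = (\<lambda>_. 0)" for i
    by (auto intro!: partial_eqI)
  then show ?case
    by (simp add: algebraic_off_0.const)
next
  case (coord j)
  have "partial i (\<lambda>p::real^'n. p $ j) = (\<lambda>_. axis i 1 $ j)" for i
    by (rule ext) (auto intro!: partial_eqI derivative_eq_intros)
  moreover have "(\<lambda>p::real^'n. p $ j) differentiable (at p)" for p
    by (intro bounded_linear_imp_differentiable bounded_linear_vec_nth)
  ultimately show ?case
    by (simp add: algebraic_off_0.const)
next
  case (add f g)
  then have D: "algebraic_off_0 (partial i f)" "algebraic_off_0 (partial i g)" for i
    by auto
  have "partial i (\<lambda>p. f p + g p) p = partial i f p + partial i g p" if "p \<noteq> 0" for i p
    by (rule partial_eqI)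
      (use DERIV_add[OF differentiable_along_axis[of f p i] differentiable_along_axis[of g p i]]
        add that in simp)
  then have "algebraic_off_0 (partial i (\<lambda>p. f p + g p))" for i
    by (rule algebraic_off_0.cong[OF algebraic_off_0.add[OF D]])
  then show ?case
    using add by auto
next
  case (mult f g)
  then have D: "algebraic_off_0 (partial i f)" "algebraic_off_0 (partial i g)" for i
    by auto
  have "partial i (\<lambda>p. f p * g p) p = f p * partial i g p + partial i f p * g p"
    if "p \<noteq> 0" for i p
  proof (rule partial_eqI)
    show "((\<lambda>t. f (p + t *\<^sub>R axis i 1) * g (p + t *\<^sub>R axis i 1)) has_real_derivative
        f p * partial i g p + partial i f p * g p) (at 0)"
      using DERIV_mult'[OF differentiable_along_axis[of f p i] differentiable_along_axis[of g p i]]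
        mult that by simp
  qed
  then have "algebraic_off_0 (partial i (\<lambda>p. f p * g p))" for i
    by (rule algebraic_off_0.cong[OF algebraic_off_0.add[OF
        algebraic_off_0.mult[OF mult.hyps(1) D(2)] algebraic_off_0.mult[OF D(1) mult.hyps(2)]]])
  then show ?case
    using mult by auto
next
  case (inverse f)
  then have D: "algebraic_off_0 (partial i f)" and inv: "algebraic_off_0 (\<lambda>p. inverse (f p))" for i
    by (auto intro: algebraic_off_0.inverse)
  have "partial i (\<lambda>p. inverse (f p)) p = (-1) * (inverse (f p) * partial i f p * inverse (f p))"
    if "p \<noteq> 0" for i p
    by (rule partial_eqI)
      (use DERIV_inverse'[OF differentiable_along_axis[of f p i]] inverse that in simp)
  then have "algebraic_off_0 (partial i (\<lambda>p. inverse (f p)))" for i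
    by (rule algebraic_off_0.cong[OF algebraic_off_0.mult[OF algebraic_off_0.const
        algebraic_off_0.mult[OF algebraic_off_0.mult[OF inv D] inv]]])
  then show ?case
    using inverse by auto
next
  case (root f m)
  then have nonzero: "f p \<noteq> 0" if "p \<noteq> 0" for p
    using root.hyps(2)[OF that] by simp
  have D: "algebraic_off_0 (partial i f)" and inv: "algebraic_off_0 (\<lambda>p. inverse (f p))"
    and root_f: "algebraic_off_0 (\<lambda>p. root m (f p))" for i
    using root nonzero by (auto intro: algebraic_off_0.inverse algebraic_off_0.root)
  have "partial i (\<lambda>p. root m (f p)) p =
      (1 / real m) * (root m (f p) * inverse (f p) * partial i f p)" if "p \<noteq> 0" for i p
  proof (rule partial_eqI)
    show "((\<lambda>t. root m (f (p + t *\<^sub>R axis i 1))) has_real_derivative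
        (1 / real m) * (root m (f p) * inverse (f p) * partial i f p)) (at 0)"
      using DERIV_chain2[OF _ differentiable_along_axis[of f p i], of "root m"]
        DERIV_real_root_pos[of m "f p"] root that by (fastforce simp: mult_ac)
  qed
  then have "algebraic_off_0 (partial i (\<lambda>p. root m (f p)))" for i
    by (rule algebraic_off_0.cong[OF algebraic_off_0.mult[OF algebraic_off_0.const
        algebraic_off_0.mult[OF algebraic_off_0.mult[OF root_f inv] D]]])
  moreover have "(\<lambda>p. root m (f p)) differentiable (at p)" if "p \<noteq> 0" for p
  proof -
    have "root m differentiable (at (f p))"
      using DERIV_real_root_pos[of m "f p"] root that
      by (auto simp: real_differentiable_def)
    then show ?thesis
      using differentiable_chain_at[of f p "root m"] root that by (simp add: o_def)
  qed
  ultimately show ?case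
    by blast
next
  case (cong f g)
  \<comment> \<open>The complement of 0 is open, so f and g agree near every nonzero p and have the
    same derivatives there.\<close>
  have "partial i g p = partial i f p" if "p \<noteq> 0" for i p
    by (rule partial_cong[OF open_Compl_0]) (use cong that in auto)
  then have "algebraic_off_0 (partial i g)" for i
    using cong.IH by (auto intro: algebraic_off_0.cong[of "partial i f"])
  moreover have "g differentiable (at p)" if "p \<noteq> 0" for p
  proof -
    from cong.IH that obtain D where "(f has_derivative D) (at p)"
      unfolding differentiable_def by blast
    then have "(g has_derivative D) (at p)"
      by (rule has_derivative_transform_within_open[OF _ open_Compl_0]) (use cong that in auto)
    then show ?thesis
      by (auto simp: differentiable_def)
  qed
  ultimately show ?case
    by blast
qed

lemma algebraic_off_0_differentiable:
  "algebraic_off_0 f \<Longrightarrow> p \<noteq> 0 \<Longrightarrow> f differentiable (at p)"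
  using algebraic_off_0_partial_aux by blast

lemma algebraic_off_0_partial: "algebraic_off_0 f \<Longrightarrow> algebraic_off_0 (partial i f)"
  using algebraic_off_0_partial_aux by blast

section \<open>Closure under sums, products, quotients and determinants\<close>

lemma algebraic_off_0_sum:
  "(\<And>i. i \<in> S \<Longrightarrow> algebraic_off_0 (f i)) \<Longrightarrow> algebraic_off_0 (\<lambda>p. \<Sum>i\<in>S. f i p)"
  by (induction S rule: infinite_finite_induct)
    (auto intro: algebraic_off_0.const algebraic_off_0.add)

lemma algebraic_off_0_prod:
  "(\<And>i. i \<in> S \<Longrightarrow> algebraic_off_0 (f i)) \<Longrightarrow> algebraic_off_0 (\<lambda>p. \<Prod>i\<in>S. f i p)"
  by (induction S rule: infinite_finite_induct)
    (auto intro: algebraic_off_0.const algebraic_off_0.mult)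

lemma algebraic_off_0_power:
  "algebraic_off_0 f \<Longrightarrow> algebraic_off_0 (\<lambda>p. f p ^ k)"
  by (induction k) (auto intro: algebraic_off_0.const algebraic_off_0.mult)

lemma algebraic_off_0_divide:
  assumes "algebraic_off_0 f" "algebraic_off_0 g" "\<And>p. p \<noteq> 0 \<Longrightarrow> g p \<noteq> 0"
  shows "algebraic_off_0 (\<lambda>p. f p / g p)"
  using algebraic_off_0.mult[OF assms(1) algebraic_off_0.inverse[OF assms(2,3)]]
  by (simp add: divide_inverse)

text \<open>The Leibniz expansion is a polynomial in the entries.\<close>

lemma algebraic_off_0_det:
  fixes A :: "real^'m::finite \<Rightarrow> real^'n::finite^'n"
  assumes "\<And>i j. algebraic_off_0 (\<lambda>p. A p $ i $ j)"
  shows "algebraic_off_0 (\<lambda>p. det (A p))"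
  unfolding det_def
  by (intro algebraic_off_0_sum algebraic_off_0.mult algebraic_off_0.const algebraic_off_0_prod assms)

lemma algebraic_off_0_monom: "algebraic_off_0 (monom_p is)"
proof (induction "is")
  case Nil
  then show ?case
    by (simp add: monom_p_def algebraic_off_0.const)
next
  case (Cons i "is")
  then show ?case
    using algebraic_off_0.mult[OF algebraic_off_0.coord[of i] Cons] by (simp add: monom_p_def)
qed

lemma partial_parity:
  assumes "algebraic_off_0 f" "p \<noteq> 0" "\<And>q. q \<noteq> 0 \<Longrightarrow> f (- q) = s * f q"
  shows "partial i f (- p) = - s * partial i f p"
  using partial_minus[OF algebraic_off_0_differentiable] assms by blast

section \<open>Symmetric forms\<close>

text \<open>The contraction of a k-index array with k copies of p. Prefixing fixed indices to the
  list gives partial contractions, so derivatives of a symmetric form are multiples of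
  forms.\<close>

definition form :: "nat \<Rightarrow> ('n list \<Rightarrow> real) \<Rightarrow> real^'n::finite \<Rightarrow> real" where
  "form k c p = (\<Sum>is | length is = k. c is * monom_p is p)"

definition symmetric_coeffs :: "nat \<Rightarrow> ('n list \<Rightarrow> real) \<Rightarrow> bool" where
  "symmetric_coeffs k c \<longleftrightarrow> (\<forall>is js. length is = k \<and> mset is = mset js \<longrightarrow> c is = c js)"

lemma symmetric_coeffs_Cons:
  "symmetric_coeffs (Suc k) c \<Longrightarrow> symmetric_coeffs k (\<lambda>is. c (i # is))"
  by (auto simp: symmetric_coeffs_def)

lemma form_swap:
  assumes "symmetric_coeffs (Suc (Suc k)) c"
  shows "form k (\<lambda>is. c (i # j # is)) p = form k (\<lambda>is. c (j # i # is)) p"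
  unfolding form_def
  by (rule sum.cong) (use assms in \<open>auto simp: symmetric_coeffs_def\<close>)

lemma algebraic_off_0_form: "algebraic_off_0 (form k c)"
  unfolding form_def
  by (intro algebraic_off_0_sum algebraic_off_0.mult algebraic_off_0.const algebraic_off_0_monom)

lemma monom_p_minus: "monom_p is (- p) = (- 1) ^ length is * monom_p is p"
  by (induction "is") (auto simp: monom_p_def)

lemma form_minus: "form k c (- p) = (- 1) ^ k * form k c p"
  unfolding form_def sum_distrib_left by (rule sum.cong) (auto simp: monom_p_minus)

lemma form_0: "form 0 c p = c []"
  by (simp add: form_def monom_p_def)

text \<open>Splits off the first index. It serves as the recursion on the degree and, when some
  leading indices are already fixed, as Euler's relation.\<close>

lemma form_Suc: "form (Suc k) c p = (\<Sum>i\<in>UNIV. p $ i * form k (\<lambda>is. c (i # is)) p)"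
proof -
  have eq: "{is::'a list. length is = Suc k} = (\<lambda>(i, is). i # is) ` (UNIV \<times> {is. length is = k})"
    by (auto simp: length_Suc_conv)
  have "form (Suc k) c p = (\<Sum>(i, is)\<in>UNIV \<times> {is. length is = k}. c (i # is) * monom_p (i # is) p)"
    unfolding form_def eq by (subst sum.reindex) (auto simp: inj_on_def intro!: sum.cong)
  also have "\<dots> = (\<Sum>i\<in>UNIV. \<Sum>is | length is = k. c (i # is) * monom_p (i # is) p)"
    by (simp add: sum.cartesian_product)
  also have "\<dots> = (\<Sum>i\<in>UNIV. p $ i * form k (\<lambda>is. c (i # is)) p)"
    by (simp add: form_def sum_distrib_left monom_p_def mult_ac)
  finally show ?thesis .
qed

text \<open>After the first index is split off, the product rule yields the wanted contraction once
  from the linear factor and, by symmetry in the first two indices and Euler's relation, k more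
  times from the other factor.\<close>

lemma form_has_derivative:
  assumes "symmetric_coeffs (Suc k) c"
  shows "(form (Suc k) c has_derivative
    (\<lambda>v. real (Suc k) * (\<Sum>j\<in>UNIV. v $ j * form k (\<lambda>is. c (j # is)) p))) (at p)"
  using assms
proof (induction k arbitrary: c)
  case 0
  have "form (Suc 0) c = (\<lambda>p. \<Sum>i\<in>UNIV. p $ i * c [i])"
    by (simp add: form_Suc form_0 fun_eq_iff)
  moreover have "((\<lambda>p. \<Sum>i\<in>UNIV. p $ i * c [i]) has_derivative (\<lambda>v. \<Sum>i\<in>UNIV. v $ i * c [i])) (at p)"
    by (intro has_derivative_sum has_derivative_mult_left
        bounded_linear_imp_has_derivative bounded_linear_vec_nth)
  ultimately show ?case
    by (simp add: form_0)
next
  case (Suc k)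
  define c2 where "c2 i j = form k (\<lambda>is. c (i # j # is)) p" for i j
  have c2: "c2 i j = c2 j i" for i j
    unfolding c2_def using form_swap[OF Suc.prems] .
  have euler: "form (Suc k) (\<lambda>is. c (i # is)) p = (\<Sum>j\<in>UNIV. p $ j * c2 i j)" for i
    by (simp add: form_Suc c2_def)
  have IH: "(form (Suc k) (\<lambda>is. c (i # is)) has_derivative
      (\<lambda>v. real (Suc k) * (\<Sum>j\<in>UNIV. v $ j * c2 i j))) (at p)" for i
    unfolding c2_def using Suc.IH[OF symmetric_coeffs_Cons[OF Suc.prems]] .
  have "((\<lambda>p. \<Sum>i\<in>UNIV. p $ i * form (Suc k) (\<lambda>is. c (i # is)) p) has_derivative
      (\<lambda>v. \<Sum>i\<in>UNIV. p $ i * (real (Suc k) * (\<Sum>j\<in>UNIV. v $ j * c2 i j))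
        + v $ i * form (Suc k) (\<lambda>is. c (i # is)) p)) (at p)"
    by (intro has_derivative_sum has_derivative_mult IH
        bounded_linear_imp_has_derivative bounded_linear_vec_nth)
  moreover have "(\<Sum>i\<in>UNIV. p $ i * (real (Suc k) * (\<Sum>j\<in>UNIV. v $ j * c2 i j))
        + v $ i * form (Suc k) (\<lambda>is. c (i # is)) p)
      = real (Suc (Suc k)) * (\<Sum>j\<in>UNIV. v $ j * form (Suc k) (\<lambda>is. c (j # is)) p)" for v
  proof -
    have "(\<Sum>i\<in>UNIV. p $ i * (real (Suc k) * (\<Sum>j\<in>UNIV. v $ j * c2 i j)))
        = real (Suc k) * (\<Sum>i\<in>UNIV. \<Sum>j\<in>UNIV. v $ j * (p $ i * c2 j i))"
      by (simp add: sum_distrib_left mult_ac c2)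
    \<comment> \<open>With the indices of \<open>c2\<close> exchanged, the sum over i is Euler's
      relation for the coefficients \<open>c (j # is)\<close>.\<close>
    also have "\<dots> = real (Suc k) * (\<Sum>j\<in>UNIV. v $ j * form (Suc k) (\<lambda>is. c (j # is)) p)"
      by (subst sum.swap) (simp add: euler sum_distrib_left)
    finally show ?thesis
      by (simp add: sum.distrib algebra_simps)
  qed
  ultimately show ?case
    by (simp add: form_Suc[of "Suc k" c, abs_def])
qed

lemma partial_form:
  assumes "symmetric_coeffs (Suc k) c"
  shows "partial i (form (Suc k) c) p = real (Suc k) * form k (\<lambda>is. c (i # is)) p"
proof -
  have "((\<lambda>t::real. p + t *\<^sub>R axis i 1) has_derivative (\<lambda>t. t *\<^sub>R axis i 1)) (at 0)"
    by (auto intro!: derivative_eq_intros)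
  from has_derivative_compose[OF this, of "form (Suc k) c"] form_has_derivative[OF assms, of p]
  have *: "((\<lambda>t. form (Suc k) c (p + t *\<^sub>R axis i 1)) has_derivative
    (\<lambda>t. real (Suc k) * (\<Sum>j\<in>UNIV. (t *\<^sub>R axis i 1) $ j * form k (\<lambda>is. c (j # is)) p))) (at 0)"
    by (simp del: vector_scaleR_component)
  have "(\<Sum>j\<in>UNIV. (t *\<^sub>R axis i 1) $ j * form k (\<lambda>is. c (j # is)) p)
      = t * form k (\<lambda>is. c (i # is)) p" for t :: real
    by (simp add: axis_def if_distrib[of "\<lambda>x. t * x * _"] if_distrib[of "\<lambda>x. x * _"] cong: if_cong)
  then have "(\<lambda>t. real (Suc k) * (\<Sum>j\<in>UNIV. (t *\<^sub>R axis i 1) $ j * form k (\<lambda>is. c (j # is)) p))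
      = (*) (real (Suc k) * form k (\<lambda>is. c (i # is)) p)"
    by (simp add: fun_eq_iff mult_ac del: vector_scaleR_component)
  with * show ?thesis
    by (intro partial_eqI) (simp only: has_field_derivative_def)
qed

section \<open>Parity of the mean Cartan torsion and the mean Landsberg curvature\<close>

text \<open>The data over one base point. \<open>a\<close> remains a function of the base point
  because \<open>christoffel\<close> differentiates it there; all other derivatives are in p.
  Evenness of m is assumed here and later derived from positivity of K.\<close>

locale reversible_mth_root =
  fixes m :: nat and a :: "'n::finite coeffs" and F :: "real^'n \<Rightarrow> real^'n \<Rightarrow> real" and x :: "real^'n"
  assumes m_ge_3: "m \<ge> 3" and even_m: "even m"
    and symmetric_a: "symmetric_coeffs m (\<lambda>is. a is x)"
    and F_eq: "F x p = root m (form m (\<lambda>is. a is x) p)"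
    and F_pos: "p \<noteq> 0 \<Longrightarrow> F x p > 0"
    and g_up_pos: "p \<noteq> 0 \<Longrightarrow> v \<noteq> 0 \<Longrightarrow> v \<bullet> (g_up F x p *v v) > 0"
begin

text \<open>\<open>A\<close> is \<open>F^m\<close>. \<open>A1\<close> and \<open>A2\<close> leave
  one and two indices of the coefficients free, without the factors m and m (m - 1) that
  differentiating \<open>A\<close> produces.\<close>

definition A :: "real^'n \<Rightarrow> real" where
  "A = form m (\<lambda>is. a is x)"

definition A1 :: "'n \<Rightarrow> real^'n \<Rightarrow> real" where
  "A1 i = form (m - 1) (\<lambda>is. a (i # is) x)"

definition A2 :: "'n \<Rightarrow> 'n \<Rightarrow> real^'n \<Rightarrow> real" where
  "A2 i j = form (m - 2) (\<lambda>is. a (i # j # is) x)"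

lemma m_Suc: "m = Suc (m - 1)" "m - 1 = Suc (m - 2)" "m = Suc (Suc (m - 2))"
  using m_ge_3 by auto

lemma symmetric_a_Suc: "symmetric_coeffs (Suc (m - 1)) (\<lambda>is. a is x)"
  by (subst m_Suc(1)[symmetric]) (rule symmetric_a)

lemma symmetric_a_Suc_Suc: "symmetric_coeffs (Suc (Suc (m - 2))) (\<lambda>is. a is x)"
  by (subst m_Suc(3)[symmetric]) (rule symmetric_a)

lemma symmetric_a1: "symmetric_coeffs (Suc (m - 2)) (\<lambda>is. a (i # is) x)"
  by (rule symmetric_coeffs_Cons[OF symmetric_a_Suc_Suc])

lemma partial_A: "partial i A p = real m * A1 i p"
  using partial_form[OF symmetric_a_Suc, of i p]
  unfolding A_def A1_def m_Suc(1)[symmetric] .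

lemma partial_A1: "partial j (A1 i) p = (real m - 1) * A2 i j p"
  using partial_form[OF symmetric_a1, of j i p] m_ge_3
  unfolding A1_def A2_def m_Suc(2)[symmetric] by (simp add: of_nat_diff)

lemma A2_commute: "A2 i j p = A2 j i p"
  unfolding A2_def by (rule form_swap[OF symmetric_a_Suc_Suc])

lemma A1_eq: "A1 i p = (\<Sum>j\<in>UNIV. p $ j * A2 i j p)"
  unfolding A1_def A2_def by (subst m_Suc(2)) (rule form_Suc)

lemma A_pos: "p \<noteq> 0 \<Longrightarrow> A p > 0"
  using F_pos[of p] m_ge_3 by (simp add: F_eq A_def)

lemma F_nonzero: "p \<noteq> 0 \<Longrightarrow> F x p \<noteq> 0"
  using F_pos[of p] by simp

lemma F_eq_root: "F x = (\<lambda>p. root m (A p))"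
  by (simp add: F_eq A_def fun_eq_iff)

lemma algebraic_A: "algebraic_off_0 A"
  by (simp add: A_def algebraic_off_0_form)

lemma algebraic_A1: "algebraic_off_0 (A1 i)"
  by (simp add: A1_def algebraic_off_0_form)

lemma algebraic_F: "algebraic_off_0 (F x)"
  unfolding F_eq_root using algebraic_A A_pos m_ge_3 by (auto intro!: algebraic_off_0.root)

lemma algebraic_F2: "algebraic_off_0 (\<lambda>p. (F x p)\<^sup>2)"
  by (intro algebraic_off_0_power algebraic_F)

lemma F_minus: "F x (- p) = F x p"
  using even_m by (simp add: F_eq form_minus)

text \<open>\<open>F^2\<close> is \<open>A\<close> to the power 2/m, so its logarithmic derivative
  is 2/m times that of \<open>A\<close>, which is \<open>m * A1 / A\<close>.\<close>

lemma DERIV_F2: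
  assumes "p \<noteq> 0"
  shows "((\<lambda>t. (F x (p + t *\<^sub>R axis i 1))\<^sup>2) has_real_derivative
    2 * (F x p)\<^sup>2 * inverse (A p) * A1 i p) (at 0)"
proof -
  have "((\<lambda>t. A (p + t *\<^sub>R axis i 1)) has_real_derivative real m * A1 i p) (at 0)"
    using differentiable_along_axis[OF algebraic_off_0_differentiable[OF algebraic_A assms]]
    by (simp add: partial_A)
  moreover have "(root m has_real_derivative root m (A p) * inverse (A p) / real m)
      (at (A (p + 0 *\<^sub>R axis i 1)))"
    using DERIV_real_root_pos[of m "A p"] A_pos[OF assms] m_ge_3 by simp
  ultimately have "((\<lambda>t. F x (p + t *\<^sub>R axis i 1)) has_real_derivative
      root m (A p) * inverse (A p) / real m * (real m * A1 i p)) (at 0)"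
    unfolding F_eq_root by (rule DERIV_chain2[rotated])
  from DERIV_power[OF this, of 2] show ?thesis
    using m_ge_3 by (simp add: F_eq_root power2_eq_square mult_ac)
qed

text \<open>Expresses the fundamental tensor through \<open>A1\<close> and \<open>A2\<close>, so
  that its positive definiteness can be used to show that \<open>a_up\<close> is invertible.\<close>

lemma g_up_eq:
  assumes "p \<noteq> 0"
  shows "g_up F x p $ i $ j = (F x p)\<^sup>2 / A p *
    ((real m - 1) * A2 i j p - (real m - 2) * A1 i p * A1 j p / A p)"
proof -
  \<comment> \<open>The formula for the inner derivative holds off 0, which is enough on a
    neighbourhood of p.\<close>
  have "partial i (partial j (\<lambda>p. (F x p)\<^sup>2)) p =
      partial i (\<lambda>p. 2 * (F x p)\<^sup>2 * inverse (A p) * A1 j p) p"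
    by (rule partial_cong[OF open_Compl_0]) (use assms in \<open>auto intro: partial_eqI DERIV_F2\<close>)
  also have "\<dots> = 2 * (2 * (F x p)\<^sup>2 * inverse (A p) * A1 i p) * inverse (A p) * A1 j p
      - 2 * (F x p)\<^sup>2 * (inverse (A p) * (real m * A1 i p) * inverse (A p)) * A1 j p
      + 2 * (F x p)\<^sup>2 * inverse (A p) * ((real m - 1) * A2 j i p)"
  proof (rule partial_eqI)
    have dA: "((\<lambda>t. A (p + t *\<^sub>R axis i 1)) has_real_derivative real m * A1 i p) (at 0)"
      using differentiable_along_axis[OF algebraic_off_0_differentiable[OF algebraic_A assms]]
      by (simp add: partial_A)
    have dA1: "((\<lambda>t. A1 j (p + t *\<^sub>R axis i 1)) has_real_derivative (real m - 1) * A2 j i p) (at 0)"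
      using differentiable_along_axis[OF algebraic_off_0_differentiable[OF algebraic_A1 assms]]
      by (simp add: partial_A1)
    note DERIV_mult[OF DERIV_mult[OF DERIV_cmult[OF DERIV_F2[OF assms], of 2]
        DERIV_inverse'[OF dA]] dA1]
    then show "((\<lambda>t. 2 * (F x (p + t *\<^sub>R axis i 1))\<^sup>2 * inverse (A (p + t *\<^sub>R axis i 1))
        * A1 j (p + t *\<^sub>R axis i 1)) has_real_derivative
      2 * (2 * (F x p)\<^sup>2 * inverse (A p) * A1 i p) * inverse (A p) * A1 j p
      - 2 * (F x p)\<^sup>2 * (inverse (A p) * (real m * A1 i p) * inverse (A p)) * A1 j p
      + 2 * (F x p)\<^sup>2 * inverse (A p) * ((real m - 1) * A2 j i p)) (at 0)"
      using A_pos[OF assms] by (simp add: algebra_simps)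
  qed
  \<comment> \<open>The two terms in \<open>A1 i p * A1 j p\<close> have coefficients 4 and -2m,
    together -2 (m - 2). The overall 2 cancels the 1/2 in \<open>g_up\<close>.\<close>
  also have "\<dots> = 2 * ((F x p)\<^sup>2 / A p *
      ((real m - 1) * A2 i j p - (real m - 2) * A1 i p * A1 j p / A p))"
    unfolding A2_commute[of j i p] divide_inverse by algebra
  finally show ?thesis
    by (simp add: g_up_def)
qed

lemma a_up_eq: "a_up m a F x p $ i $ j = A2 i j p / F x p ^ (m - 2)"
  by (simp add: a_up_def A2_def form_def)

text \<open>A vector in the kernel of \<open>a\<^sup>i\<^sup>j\<close> is annihilated by \<open>a\<^sup>i = a\<^sup>i\<^sup>jp\<^sub>j\<close>, hence by
  \<open>g\<^sup>i\<^sup>j = (m - 1) a\<^sup>i\<^sup>j - (m - 2) a\<^sup>i a\<^sup>j\<close>.\<close>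

lemma det_a_up:
  assumes "p \<noteq> 0"
  shows "det (a_up m a F x p) \<noteq> 0"
proof -
  have "v = 0" if v: "a_up m a F x p *v v = 0" for v
  proof -
    have A2v: "(\<Sum>j\<in>UNIV. A2 i j p * v $ j) = 0" for i
    proof -
      have "(\<Sum>j\<in>UNIV. A2 i j p * v $ j) / F x p ^ (m - 2) = (a_up m a F x p *v v) $ i"
        by (simp add: matrix_vector_mult_def a_up_eq sum_divide_distrib)
      then show ?thesis
        using v F_pos[OF assms] by simp
    qed
    have "(\<Sum>j\<in>UNIV. A1 j p * v $ j) = (\<Sum>j\<in>UNIV. \<Sum>i\<in>UNIV. p $ i * (A2 i j p * v $ j))"
      unfolding A1_eq sum_distrib_right
      by (intro sum.cong refl) (simp add: A2_commute[of _ j for j])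
    also have "\<dots> = (\<Sum>i\<in>UNIV. p $ i * (\<Sum>j\<in>UNIV. A2 i j p * v $ j))"
      by (subst sum.swap) (simp add: sum_distrib_left)
    finally have A1v: "(\<Sum>j\<in>UNIV. A1 j p * v $ j) = 0"
      by (simp add: A2v)
    have "(g_up F x p *v v) $ i = 0" for i
    proof -
      have "(g_up F x p *v v) $ i = (\<Sum>j\<in>UNIV. (F x p)\<^sup>2 / A p * (real m - 1) * (A2 i j p * v $ j)
          - (F x p)\<^sup>2 / A p * ((real m - 2) * A1 i p / A p) * (A1 j p * v $ j))"
        unfolding matrix_vector_mult_def g_up_eq[OF assms] vec_lambda_beta
        by (intro sum.cong refl) (simp add: divide_inverse algebra_simps)
      also have "\<dots> = 0"
        by (simp only: sum_subtractf sum_distrib_left[symmetric] A1v A2v mult_zero_right diff_0_right)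
      finally show ?thesis .
    qed
    then have "g_up F x p *v v = 0"
      by (simp add: vec_eq_iff)
    then show "v = 0"
      using g_up_pos[OF assms, of v] by fastforce
  qed
  then show ?thesis
    by (metis invertible_det_nz invertible_left_inverse matrix_left_invertible_ker)
qed

section \<open>Spray coefficients by Cramer's rule\<close>

definition spray_rhs :: "'n \<Rightarrow> real^'n \<Rightarrow> real" where
  "spray_rhs h p = 1 / (real m * F x p ^ (m - 2)) * christoffel0 m a h x p"

text \<open>Cramer's rule is an equivalence once the determinant is nonzero: it gives the existence
  and uniqueness that the definite description in \<open>spray\<close> requires, and a quotient of
  determinants that stays in \<open>algebraic_off_0\<close>.\<close>

lemma spray_eq:
  assumes "p \<noteq> 0"
  shows "spray m a F x p $ k =
    det (\<chi> i j. if j = k then spray_rhs i p else a_up m a F x p $ i $ j) / det (a_up m a F x p)"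
proof -
  have "(\<forall>h. (\<Sum>r\<in>UNIV. a_up m a F x p $ h $ r * G $ r)
          = 1 / (real m * F x p ^ (m - 2)) * christoffel0 m a h x p) \<longleftrightarrow>
      G = (\<chi> k. det (\<chi> i j. if j = k then spray_rhs i p else a_up m a F x p $ i $ j)
        / det (a_up m a F x p))" for G
    using cramer[OF det_a_up[OF assms], of G "\<chi> h. spray_rhs h p"]
    by (simp add: matrix_vector_mult_def spray_rhs_def vec_lambda_inject fun_eq_iff cong: if_cong)
  then show ?thesis
    by (simp add: spray_def)
qed

lemma algebraic_a_up: "algebraic_off_0 (\<lambda>p. a_up m a F x p $ i $ j)"
  unfolding a_up_eq A2_def
  by (intro algebraic_off_0_divide algebraic_off_0_form algebraic_off_0_power algebraic_F)
    (simp add: F_nonzero)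

lemma algebraic_spray_rhs: "algebraic_off_0 (spray_rhs h)"
proof -
  have "algebraic_off_0 (\<lambda>p. christoffel0 m a h x p / (real m * F x p ^ (m - 2)))"
    \<comment> \<open>The Christoffel symbols are constants in p, so \<open>christoffel0\<close> is
      a form of degree m.\<close>
    unfolding christoffel0_def form_def[symmetric]
    by (intro algebraic_off_0_divide algebraic_off_0_form algebraic_off_0.mult algebraic_off_0.const
        algebraic_off_0_power algebraic_F)
      (use m_ge_3 in \<open>simp add: F_nonzero\<close>)
  then show ?thesis
    by (simp add: spray_rhs_def[abs_def])
qed

lemma algebraic_spray: "algebraic_off_0 (\<lambda>p. spray m a F x p $ k)"
proof (rule algebraic_off_0.cong[OF _ spray_eq])
  show "algebraic_off_0 (\<lambda>p. det (\<chi> i j. if j = k then spray_rhs i p else a_up m a F x p $ i $ j)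
      / det (a_up m a F x p))"
    by (intro algebraic_off_0_divide algebraic_off_0_det det_a_up algebraic_a_up)
      (rename_tac i j, case_tac "j = k", auto intro: algebraic_a_up algebraic_spray_rhs)
qed

section \<open>Behaviour of the derived tensors under the reflection of p\<close>

lemma g_up_minus:
  assumes "p \<noteq> 0"
  shows "g_up F x (- p) = g_up F x p"
proof -
  \<comment> \<open>The explicit factor \<open>-1\<close> is the s with which
    \<open>partial_parity\<close> is applied to the second derivative.\<close>
  have "partial j (\<lambda>p. (F x p)\<^sup>2) (- q) = -1 * partial j (\<lambda>p. (F x p)\<^sup>2) q" if "q \<noteq> 0" for j q
    using partial_parity[OF algebraic_F2 that, where s = 1] by (simp add: F_minus)
  from partial_parity[OF algebraic_off_0_partial[OF algebraic_F2] assms this]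
  show ?thesis
    by (simp add: g_up_def vec_eq_iff)
qed

lemma g_down_minus: "p \<noteq> 0 \<Longrightarrow> g_down F x (- p) = g_down F x p"
  by (simp add: g_down_def g_up_minus)

lemma cartan_torsion_minus:
  assumes "p \<noteq> 0"
  shows "cartan_torsion F i j k x (- p) = - cartan_torsion F i j k x p"
proof -
  have "algebraic_off_0 (\<lambda>p. g_up F x p $ i $ j)"
    unfolding g_up_def
    by (simp add: algebraic_off_0.mult[OF algebraic_off_0.const[of "1/2"]] algebraic_off_0_partial algebraic_F2
        del: times_divide_eq_left mult_1)
  from partial_parity[OF this assms, where s = 1] show ?thesis
    by (simp add: cartan_torsion_def g_up_minus)
qed

lemma mean_cartan_minus:
  assumes "p \<noteq> 0"
  shows "mean_cartan F i x (- p) = - mean_cartan F i x p"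
  by (simp add: mean_cartan_def g_down_minus cartan_torsion_minus assms sum_negf)

lemma p_up_minus: "p \<noteq> 0 \<Longrightarrow> p_up F s x (- p) = - p_up F s x p"
  by (simp add: p_up_def g_up_minus sum_negf)

text \<open>The defining linear system is literally the same at p and -p: its forms have the even
  degrees m - 2 and m, and F is reversible.\<close>

lemma spray_minus: "spray m a F x (- p) = spray m a F x p"
proof -
  have "a_up m a F x (- p) = a_up m a F x p"
    using even_m by (simp add: vec_eq_iff a_up_eq A2_def form_minus F_minus)
  moreover have "christoffel0 m a h x (- p) = christoffel0 m a h x p" for h
    using even_m unfolding christoffel0_def form_def[symmetric] by (simp add: form_minus)
  ultimately show ?thesis
    by (simp add: spray_def F_minus)
qed

lemma berwald_minus:
  assumes "p \<noteq> 0"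
  shows "berwald m a F i j k r x (- p) = - berwald m a F i j k r x p"
proof -
  let ?G = "\<lambda>p. spray m a F x p $ r"
  \<comment> \<open>Starting from an even function, the sign alternates with each derivative, and
    each fact supplies the s for the next.\<close>
  have 1: "partial i ?G (- q) = -1 * partial i ?G q" if "q \<noteq> 0" for q
    using partial_parity[OF algebraic_spray that, where s = 1] by (simp add: spray_minus)
  have 2: "partial j (partial i ?G) (- q) = 1 * partial j (partial i ?G) q" if "q \<noteq> 0" for q
    using partial_parity[OF algebraic_off_0_partial[OF algebraic_spray] that 1] by simp
  show ?thesis
    using partial_parity[OF algebraic_off_0_partial[OF algebraic_off_0_partial[OF algebraic_spray]] assms 2]
    by (simp add: berwald_def)
qed

lemma mean_landsberg_minus:
  assumes "p \<noteq> 0"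
  shows "mean_landsberg m a F i x (- p) = mean_landsberg m a F i x p"
  by (simp add: mean_landsberg_def landsberg_def g_down_minus p_up_minus berwald_minus assms)

text \<open>The value c belongs to the base point and is therefore the same at p and -p. Adding the
  relations at p and -p removes the torsion term.\<close>

lemma isotropic_imp_mean_landsberg_0:
  assumes "p \<noteq> 0"
    and iso: "\<And>q. q \<noteq> 0 \<Longrightarrow> mean_landsberg m a F i x q + c * F x q * mean_cartan F i x q = 0"
  shows "mean_landsberg m a F i x p = 0"
proof -
  have "mean_landsberg m a F i x p - c * F x p * mean_cartan F i x p = 0"
    using iso[of "- p"] \<open>p \<noteq> 0\<close> by (simp add: mean_landsberg_minus mean_cartan_minus F_minus)
  with iso[OF \<open>p \<noteq> 0\<close>] show ?thesis
    by linarith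
qed

end

section \<open>Covectors\<close>

context
  fixes M :: "'a topology" and \<A> :: "('a, 'n::finite) chart set"
  assumes manifold: "smooth_manifold M \<A>"
begin

lemma openin_chart: "ch \<in> \<A> \<Longrightarrow> openin M (fst ch)"
  using manifold unfolding smooth_manifold_def by blast

lemma chart_homeomorphic:
  "ch \<in> \<A> \<Longrightarrow> homeomorphic_map (subtopology M (fst ch)) (top_of_set (chart_range ch)) (snd ch)"
  using manifold unfolding smooth_manifold_def by blast

lemma open_chart_range: "ch \<in> \<A> \<Longrightarrow> open (chart_range ch)"
  using manifold unfolding smooth_manifold_def by blast

lemma chart_inj:
  assumes "ch \<in> \<A>"
  shows "inj_on (snd ch) (fst ch)"
  using homeomorphic_imp_injective_map[OF chart_homeomorphic[OF assms]]
    openin_subset[OF openin_chart[OF assms]]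
  by (simp add: Int_absorb1)

lemma chart_inv_chart: "ch \<in> \<A> \<Longrightarrow> q \<in> fst ch \<Longrightarrow> chart_inv ch (snd ch q) = q"
  by (simp add: chart_inv_def inv_into_f_f chart_inj)

lemma chart_inv_in: "x \<in> chart_range ch \<Longrightarrow> chart_inv ch x \<in> fst ch"
  by (simp add: chart_range_def chart_inv_def inv_into_into)

text \<open>The chart is a homeomorphism onto its range, which gives relative openness; the range is
  itself open.\<close>

lemma open_chart_image:
  assumes "ch \<in> \<A>" "openin M U" "U \<subseteq> fst ch"
  shows "open (snd ch ` U)"
proof -
  have "openin (subtopology M (fst ch)) U"
    using openin_chart[OF assms(1)] assms(2,3) by (simp add: openin_open_subtopology)
  then have "openin (top_of_set (chart_range ch)) (snd ch ` U)"
    using homeomorphic_imp_open_map[OF chart_homeomorphic[OF assms(1)]] unfolding open_map_def by blast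
  then show ?thesis
    using open_chart_range[OF assms(1)] by (simp add: openin_open_eq)
qed

lemma transition_has_derivative:
  assumes "ch \<in> \<A>" "ch' \<in> \<A>" "q \<in> fst ch" "q \<in> fst ch'"
  shows "(transition ch ch' has_derivative
    (\<lambda>v. jacobian (transition ch ch') (at (snd ch q)) *v v)) (at (snd ch q))"
proof -
  \<comment> \<open>Smoothness at order 1 makes the Jacobian a genuine derivative.\<close>
  have "Ck_on (Suc 0) (snd ch ` (fst ch \<inter> fst ch')) (transition ch ch')"
    using manifold assms(1,2) unfolding smooth_manifold_def smooth_on_def by blast
  then have "transition ch ch' differentiable (at (snd ch q))"
    using assms(3,4) by simp
  then show ?thesis
    using jacobian_works by blast
qed

lemma transition_chart: "ch \<in> \<A> \<Longrightarrow> q \<in> fst ch \<Longrightarrow> transition ch ch' (snd ch q) = snd ch' q"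
  by (simp add: transition_def chart_inv_chart)

text \<open>The chain rule at a point of a triple overlap, together with uniqueness of
  derivatives.\<close>

lemma jacobian_transition_trans:
  assumes ch: "ch \<in> \<A>" "ch' \<in> \<A>" "ch'' \<in> \<A>" and q: "q \<in> fst ch" "q \<in> fst ch'" "q \<in> fst ch''"
  shows "jacobian (transition ch ch'') (at (snd ch q)) =
    jacobian (transition ch' ch'') (at (snd ch' q)) ** jacobian (transition ch ch') (at (snd ch q))"
proof -
  let ?U = "fst ch \<inter> fst ch' \<inter> fst ch''"
  have "(transition ch' ch'' has_derivative
      (\<lambda>v. jacobian (transition ch' ch'') (at (snd ch' q)) *v v)) (at (transition ch ch' (snd ch q)))"
    using transition_has_derivative[of ch' ch'' q] ch q by (simp add: transition_chart)
  from has_derivative_compose[OF transition_has_derivative[of ch ch' q] this]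
  have "((\<lambda>y. transition ch' ch'' (transition ch ch' y)) has_derivative
      (\<lambda>v. jacobian (transition ch' ch'') (at (snd ch' q)) *v
        (jacobian (transition ch ch') (at (snd ch q)) *v v))) (at (snd ch q))"
    using ch q by simp
  \<comment> \<open>The composite is compared with the direct transition on the coordinate image of
    the triple overlap, so this image must be a neighbourhood of the point.\<close>
  moreover have "open (snd ch ` ?U)"
    using ch by (intro open_chart_image openin_Int openin_chart) auto
  ultimately have "(transition ch ch'' has_derivative
      (\<lambda>v. jacobian (transition ch' ch'') (at (snd ch' q)) *v
        (jacobian (transition ch ch') (at (snd ch q)) *v v))) (at (snd ch q))"
    by (rule has_derivative_transform_within_open) (use ch q in \<open>auto simp: transition_chart\<close>)
  from has_derivative_unique[OF this transition_has_derivative[of ch ch'' q]] show ?thesis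
    using ch q by (auto simp: matrix_eq matrix_vector_mul_assoc fun_eq_iff)
qed

lemma jacobian_transition_refl:
  assumes "ch \<in> \<A>" "q \<in> fst ch"
  shows "jacobian (transition ch ch) (at (snd ch q)) = mat 1"
proof -
  have "(transition ch ch has_derivative (\<lambda>v. v)) (at (snd ch q))"
    by (rule has_derivative_transform_within_open[OF has_derivative_ident,
          of "snd ch ` fst ch"])
      (use assms in \<open>auto simp: transition_chart intro: open_chart_image openin_chart\<close>)
  from has_derivative_unique[OF this transition_has_derivative[of ch ch q]] show ?thesis
    using assms by (auto simp: matrix_eq fun_eq_iff)
qed

text \<open>The transposed chain rule is the transformation law of covectors. Positivity of K is
  assumed on cotangent spaces, so this is what makes it apply to \<open>local_expr\<close>.\<close>

lemma covector_of_in_cotangent_space: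
  assumes "ch \<in> \<A>" "x \<in> chart_range ch"
  shows "covector_of \<A> ch x p \<in> cotangent_space \<A> (chart_inv ch x)"
proof -
  let ?q = "chart_inv ch x"
  have out: "covector_of \<A> ch x p ch' = 0" if "\<not> (ch' \<in> \<A> \<and> ?q \<in> fst ch')" for ch'
    using that unfolding covector_of_def by (rule if_not_P)
  have covector: "covector_of \<A> ch x p ch' = transpose (jacobian (transition ch' ch) (at (snd ch' ?q))) *v p"
    if "ch' \<in> \<A>" "?q \<in> fst ch'" for ch'
    unfolding covector_of_def using that by (intro if_P conjI)
  have "covector_of \<A> ch x p ch1 =
      transpose (jacobian (transition ch1 ch2) (at (snd ch1 ?q))) *v covector_of \<A> ch x p ch2"
    if "ch1 \<in> \<A>" "ch2 \<in> \<A>" "?q \<in> fst ch1" "?q \<in> fst ch2" for ch1 ch2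
    unfolding covector[OF that(1,3)] covector[OF that(2,4)]
      jacobian_transition_trans[OF that(1,2) assms(1) that(3,4) chart_inv_in[OF assms(2)]]
    by (simp only: matrix_transpose_mul matrix_vector_mul_assoc)
  with out show ?thesis
    unfolding cotangent_space_def by blast
qed

text \<open>The component in the chart \<open>ch\<close> itself is p, because the transition from a
  chart to itself has identity Jacobian.\<close>

lemma covector_of_nonzero:
  assumes "ch \<in> \<A>" "x \<in> chart_range ch" "p \<noteq> 0"
  shows "covector_of \<A> ch x p \<noteq> (\<lambda>_. 0)"
proof -
  have "snd ch (chart_inv ch x) = x"
    using assms by (simp add: chart_range_def chart_inv_def f_inv_into_f)
  then have "covector_of \<A> ch x p ch = p"
    using assms chart_inv_in[of x ch] jacobian_transition_refl[of ch "chart_inv ch x"]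
    by (simp add: covector_of_def transpose_mat)
  then show ?thesis
    using assms by auto
qed

end

section \<open>Reduction of the global statement to one point of one chart\<close>

lemma mth_root_Cartan_space_reversible_mth_root:
  fixes \<A> :: "('a, 'n::finite) chart set"
  assumes K: "mth_root_Cartan_space m M \<A> a K" and ch: "ch \<in> \<A>" "x \<in> chart_range ch"
  shows "reversible_mth_root m (a ch) (local_expr \<A> K ch) x"
proof -
  let ?F = "local_expr \<A> K ch"
  have m: "m \<ge> 3" and C: "Cartan_space M \<A> K"
    using K by (simp_all add: mth_root_Cartan_space_def)
  have F: "?F x p = root m (form m (\<lambda>is. a ch is x) p)" for p
    using K ch unfolding mth_root_Cartan_space_def form_def by blast
  have "\<forall>is js. length is = m \<and> mset is = mset js \<longrightarrow> (\<forall>x\<in>chart_range ch. a ch is x = a ch js x)"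
    using K ch(1) unfolding mth_root_Cartan_space_def by blast
  then have sym: "symmetric_coeffs m (\<lambda>is. a ch is x)"
    using ch(2) unfolding symmetric_coeffs_def by blast
  have manifold: "smooth_manifold M \<A>"
    and K_pos: "\<forall>q\<in>topspace M. \<forall>\<omega>\<in>cotangent_space \<A> q. \<omega> \<noteq> (\<lambda>_. 0) \<longrightarrow> K q \<omega> > 0"
    using C unfolding Cartan_space_def by blast+
  have "\<forall>x\<in>chart_range ch. \<forall>p. p \<noteq> 0 \<longrightarrow> (\<forall>v. v \<noteq> 0 \<longrightarrow> v \<bullet> (g_up ?F x p *v v) > 0)"
    using C ch(1) unfolding Cartan_space_def by blast
  then have g_pos: "v \<bullet> (g_up ?F x p *v v) > 0" if "p \<noteq> 0" "v \<noteq> 0" for p v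
    using ch(2) that by blast
  have "chart_inv ch x \<in> topspace M"
    using chart_inv_in[OF manifold ch(2)] openin_subset[OF openin_chart[OF manifold ch(1)]] by blast
  \<comment> \<open>A nonzero p represents a nonzero element of the cotangent space, where K is
    positive.\<close>
  then have pos: "?F x p > 0" if "p \<noteq> 0" for p
    unfolding local_expr_def
    using K_pos covector_of_in_cotangent_space[OF manifold ch] covector_of_nonzero[OF manifold ch that]
    by blast
  have "even m"
  proof (rule ccontr)
    assume "odd m"
    \<comment> \<open>The real \<open>root\<close> is an odd function, so for odd m the local
      expression is odd in p and cannot be positive at both p and -p.
      \<open>axis undefined 1\<close> is merely some nonzero vector.\<close>
    then have "?F x (- axis undefined 1) = - ?F x (axis undefined 1)"
      by (simp add: F form_minus real_root_minus)
    then show False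
      using pos[of "axis undefined 1"] pos[of "- axis undefined 1"] by (simp add: axis_eq_0_iff)
  qed
  show ?thesis
    by (rule reversible_mth_root.intro) (fact m \<open>even m\<close> sym F pos g_pos)+
qed

theorem theorem1p2:
  fixes M :: "'a topology"
    and \<A> :: "('a, 'n::finite) chart set"
    and a :: "('a, 'n) chart \<Rightarrow> 'n coeffs"
    and K :: "'a \<Rightarrow> ('a, 'n) covector \<Rightarrow> real"
    and m :: nat
  assumes "m \<ge> 3"
    and "mth_root_Cartan_space m M \<A> a K"
    and "isotropic_mean_landsberg m \<A> a K"
  shows "weakly_landsberg m \<A> a K"
proof -
  obtain c where c: "\<forall>ch\<in>\<A>. \<forall>x\<in>chart_range ch. \<forall>p. p \<noteq> 0 \<longrightarrow> (\<forall>i.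
      mean_landsberg m (a ch) (local_expr \<A> K ch) i x p
        + c (chart_inv ch x) * local_expr \<A> K ch x p * mean_cartan (local_expr \<A> K ch) i x p = 0)"
    using assms(3) unfolding isotropic_mean_landsberg_def by (elim exE)
  show ?thesis
    unfolding weakly_landsberg_def
  proof (intro ballI allI impI)
    fix ch and x p :: "real^'n" and i
    assume ch: "ch \<in> \<A>" "x \<in> chart_range ch" and "p \<noteq> 0"
    interpret reversible_mth_root m "a ch" "local_expr \<A> K ch" x
      by (rule mth_root_Cartan_space_reversible_mth_root[OF assms(2) ch])
    show "mean_landsberg m (a ch) (local_expr \<A> K ch) i x p = 0"
      \<comment> \<open>The value of c used at both p and -p is
        \<open>c (chart_inv ch x)\<close>.\<close>
      using c ch by (intro isotropic_imp_mean_landsberg_0[OF \<open>p \<noteq> 0\<close>]) auto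
  qed
qed

end
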